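(* A tree $G$ with $n\geq 3$ vertices has exactly two main signless Laplacian eigenvalues if and only if $G$ is the star $S_n$ or the double star $S_{\frac{n}{2},\frac{n}{2}}$.
   Context: For a graph $G$ with adjacency matrix $A$ and diagonal degree matrix $D$, the signless Laplacian is $Q=D+A$; an eigenvalue of $Q$ is a main signless Laplacian eigenvalue if it has an eigenvector whose entries do not sum to zero. $S_n$ is the star $K_{1,n-1}$. For even $n$, the double star $S_{\frac{n}{2},\frac{n}{2}}$ is the tree on $n$ vertices consisting of two adjacent vertices, each of which is additionally adjacent to $\frac{n}{2}-1$ pendant vertices. *)

theory Defs
  imports "Graph_Theory.Graph_Theory" "Jordan_Normal_Form.Char_Poly"
begin

text \<open>
  Finite simple undirected graphs are the symmetric digraphs of the locale \<^locale>\<open>graph\<close>, every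
  edge being a pair of opposite arcs.  In such a digraph the walk \<open>a, b, a\<close> already counts as a
  \<^const>\<open>pre_digraph.cycle\<close>, so the library predicate for trees fails as soon as there is an edge;
  undirected cycles are the directed ones of length at least three.
\<close>

definition undirected_tree :: "('a, 'b) pre_digraph \<Rightarrow> bool" where
  "undirected_tree G \<longleftrightarrow>
     graph G \<and> Digraph_Component.connected G \<and>
     \<not> (\<exists>p. pre_digraph.cycle G p \<and> 3 \<le> length p)"

text \<open>
  The double star with parameters \<open>a, b \<ge> 1\<close>: adjacent centres \<open>u\<close> and \<open>v\<close>, with \<open>a - 1\<close> pendant
  vertices at \<open>u\<close> and \<open>b - 1\<close> at \<open>v\<close>.
\<close>

definition double_star :: "nat \<Rightarrow> nat \<Rightarrow> ('a, 'b) pre_digraph \<Rightarrow> bool" where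
  "double_star a b G \<longleftrightarrow>
     graph G \<and>
     (\<exists>u v L M. verts G = {u, v} \<union> L \<union> M \<and>
        u \<noteq> v \<and> u \<notin> L \<union> M \<and> v \<notin> L \<union> M \<and> L \<inter> M = {} \<and>
        card L + 1 = a \<and> card M + 1 = b \<and>
        arcs_ends G = ({(u, v)} \<union> {u} \<times> L \<union> {v} \<times> M)\<^sup>s)"

text \<open>
  Matrices are taken with respect to an enumeration \<open>vs\<close> of the vertices.  In a symmetric digraph
  the out-degree of a vertex is its degree as a vertex of the undirected graph.
\<close>

definition adjacency_mat :: "('a, 'b) pre_digraph \<Rightarrow> 'a list \<Rightarrow> real mat" where
  "adjacency_mat G vs =
     mat (length vs) (length vs) (\<lambda>(i, j). if (vs ! i, vs ! j) \<in> arcs_ends G then 1 else 0)"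

definition degree_mat :: "('a, 'b) pre_digraph \<Rightarrow> 'a list \<Rightarrow> real mat" where
  "degree_mat G vs =
     mat (length vs) (length vs) (\<lambda>(i, j). if i = j then real (out_degree G (vs ! i)) else 0)"

definition signless_laplacian :: "('a, 'b) pre_digraph \<Rightarrow> 'a list \<Rightarrow> real mat" where
  "signless_laplacian G vs = degree_mat G vs + adjacency_mat G vs"

definition main_signless_laplacian_eigenvalue ::
    "('a, 'b) pre_digraph \<Rightarrow> 'a list \<Rightarrow> real \<Rightarrow> bool" where
  "main_signless_laplacian_eigenvalue G vs \<mu> \<longleftrightarrow>
     (\<exists>x. eigenvector (signless_laplacian G vs) x \<mu> \<and> (\<Sum>i<dim_vec x. x $ i) \<noteq> 0)"

end

theory Submission
  imports Defs "HOL-Computational_Algebra.Fundamental_Theorem_Algebra"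
begin

text \<open>
  If \<open>Q\<close> has only the main eigenvalues \<open>\<mu>\<^sub>1\<close>, \<open>\<mu>\<^sub>2\<close>, then \<open>(Q - \<mu>\<^sub>1)(Q - \<mu>\<^sub>2)\<close> kills the all-ones vector,
  which says that the degrees \<open>d\<close> satisfy \<open>(\<Sum>w \<sim> v. d w) = a d v - (d v)\<^sup>2 + b\<close> for constants \<open>a\<close>, \<open>b\<close>.
  Let \<open>x, y, z, u, \<dots>\<close> be a longest path of the tree.  All neighbours of \<open>y\<close> except \<open>z\<close> are leaves, and
  every neighbour of a leaf has the same degree \<open>k = d y\<close>.  If the path ends at \<open>z\<close>, the tree is a star.
  Otherwise, if \<open>z\<close> has a leaf neighbour, then \<open>d z = k\<close>, and the degree equations at \<open>y\<close> and \<open>z\<close> leave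
  degree one for all neighbours of \<open>z\<close> except \<open>y\<close>, a balanced double star.  If it has none, all its
  neighbours except \<open>u\<close> have degree \<open>k\<close>, and the equations for \<open>x\<close>, \<open>y\<close>, \<open>z\<close> have no solution in integers.
\<close>

section \<open>Krylov spaces of self-adjoint operators\<close>

text \<open>Functions on \<open>V\<close> form a space of dimension \<open>card V\<close>, and here
  there is one more of them. It yields the annihilating polynomial below.\<close>

lemma linear_dependence:
  fixes F :: "nat \<Rightarrow> 'a \<Rightarrow> real"
  assumes "finite V"
  shows "\<exists>c. (\<exists>i\<le>card V. c i \<noteq> 0) \<and> (\<forall>v\<in>V. (\<Sum>i\<le>card V. c i * F i v) = 0)"
proof -
  define n where "n = card V"
  obtain h where h: "bij_betw h {0..<n} V"
    using ex_bij_betw_nat_finite[OF assms] unfolding n_def by blast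
  define r where "r = (\<lambda>k. vec (Suc n) (\<lambda>i. F i (h k)))"
  \<comment> \<open>Row \<open>k\<close> holds the values at the \<open>k\<close>-th point of
    \<open>V\<close>. The extra zero row makes the matrix square and singular, and a kernel vector
    is the wanted family of coefficients.\<close>
  define A where "A = mat\<^sub>r (Suc n) (Suc n) (\<lambda>k. if k = n then 0\<^sub>v (Suc n) else r k)"
  have A: "A \<in> carrier_mat (Suc n) (Suc n)" unfolding A_def by simp
  have "det A = 0" unfolding A_def by (rule det_row_0) (auto simp: r_def)
  then obtain x where x: "x \<in> carrier_vec (Suc n)" "x \<noteq> 0\<^sub>v (Suc n)" "A *\<^sub>v x = 0\<^sub>v (Suc n)"
    using det_0_iff_vec_prod_zero[OF A] by blast
  have "\<exists>i\<le>n. x $ i \<noteq> 0"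
  proof (rule ccontr)
    assume "\<not> ?thesis"
    then have "x = 0\<^sub>v (Suc n)" using x(1) by (intro eq_vecI) auto
    with x(2) show False by simp
  qed
  moreover have "(\<Sum>i\<le>n. x $ i * F i v) = 0" if v: "v \<in> V" for v
  proof -
    obtain k where k: "k < n" "v = h k"
      using h v unfolding bij_betw_def by auto
    have "0 = (A *\<^sub>v x) $ k" using x(3) k by simp
    also have "\<dots> = row A k \<bullet> x" using A k by simp
    also have "row A k = r k" unfolding A_def using k by (simp add: r_def)
    also have "r k \<bullet> x = (\<Sum>i<Suc n. F i v * x $ i)"
      using x(1) k unfolding scalar_prod_def r_def by (auto simp: atLeast0LessThan intro!: sum.cong)
    finally show ?thesis by (simp add: lessThan_Suc_atMost mult.commute)
  qed
  ultimately show ?thesis unfolding n_def by blast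
qed

section \<open>Real polynomials evaluated at complex points\<close>

lemma poly_of_real_pCons:
  fixes z :: "'b :: {real_algebra_1, comm_ring_1}"
  shows "poly (map_poly of_real (pCons a p)) z = of_real a + z * poly (map_poly of_real p) z"
  by (cases "a = 0 \<and> p = 0") auto

lemma poly_of_real_add:
  fixes z :: "'b :: {real_algebra_1, comm_ring_1}"
  shows "poly (map_poly of_real (p + q)) z = poly (map_poly of_real p) z + poly (map_poly of_real q) z"
  by (induction p q rule: poly_induct2) (simp_all add: poly_of_real_pCons algebra_simps)

lemma poly_of_real_smult:
  fixes z :: "'b :: {real_algebra_1, comm_ring_1}"
  shows "poly (map_poly of_real (Polynomial.smult a p)) z = of_real a * poly (map_poly of_real p) z"
  by (induction p) (simp_all add: poly_of_real_pCons algebra_simps)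

lemma poly_of_real_mult:
  fixes z :: "'b :: {real_algebra_1, comm_ring_1}"
  shows "poly (map_poly of_real (p * q)) z = poly (map_poly of_real p) z * poly (map_poly of_real q) z"
  by (induction p)
    (simp_all add: poly_of_real_pCons poly_of_real_add poly_of_real_smult algebra_simps)

section \<open>Polynomials in a self-adjoint operator\<close>

text \<open>Linearity is an equation between functions on the whole type, so that it rewrites
  without membership conditions; only the inner product is confined to \<open>V\<close>.\<close>

locale self_adjoint_operator =
  fixes V :: "'a set" and T :: "('a \<Rightarrow> real) \<Rightarrow> 'a \<Rightarrow> real"
  assumes finite_V: "finite V"
    and linear: "T (\<lambda>v. a * f v + b * g v) = (\<lambda>v. a * T f v + b * T g v)"
    and self_adjoint: "(\<Sum>v\<in>V. f v * T g v) = (\<Sum>v\<in>V. T f v * g v)"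
begin

lemma op_add: "T (\<lambda>v. f v + g v) = (\<lambda>v. T f v + T g v)"
  using linear[of 1 f 1 g] by simp

lemma op_scale: "T (\<lambda>v. a * f v) = (\<lambda>v. a * T f v)"
  using linear[of a f 0 f] by simp

lemma op_zero: "T (\<lambda>v. 0) = (\<lambda>v. 0)"
  using linear[of 0 _ 0] by simp

text \<open>This is \<open>p(T) f\<close> in Horner form, which fits induction over
  \<open>pCons\<close>.\<close>

definition poly_op :: "real poly \<Rightarrow> ('a \<Rightarrow> real) \<Rightarrow> 'a \<Rightarrow> real" where
  "poly_op p f = fold_coeffs (\<lambda>a g v. a * f v + T g v) p (\<lambda>_. 0)"

lemma poly_op_0 [simp]: "poly_op 0 f = (\<lambda>_. 0)"
  by (simp add: poly_op_def)

lemma poly_op_pCons: "poly_op (pCons a p) f = (\<lambda>v. a * f v + T (poly_op p f) v)"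
  by (cases "p = 0 \<and> a = 0") (auto simp: poly_op_def op_zero)

lemma poly_op_add: "poly_op (p + q) f = (\<lambda>v. poly_op p f v + poly_op q f v)"
proof (induction p q rule: poly_induct2)
  case (pCons a p b q)
  then show ?case by (simp add: poly_op_pCons op_add algebra_simps)
qed simp

lemma poly_op_smult: "poly_op (Polynomial.smult a p) f = (\<lambda>v. a * poly_op p f v)"
  by (induction p) (simp_all add: poly_op_pCons op_scale algebra_simps)

lemma poly_op_mult: "poly_op (p * q) f = poly_op p (poly_op q f)"
  by (induction p) (simp_all add: poly_op_pCons poly_op_add poly_op_smult)

lemma poly_op_monom: "poly_op (Polynomial.monom c n) f = (\<lambda>v. c * (T ^^ n) f v)"
  by (induction n) (simp_all add: monom_0 monom_Suc poly_op_pCons op_zero op_scale)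

lemma poly_op_sum_monom:
  "finite I \<Longrightarrow> poly_op (\<Sum>i\<in>I. Polynomial.monom (c i) i) f = (\<lambda>v. \<Sum>i\<in>I. c i * (T ^^ i) f v)"
  by (induction I rule: finite_induct) (simp_all add: poly_op_add poly_op_monom)

text \<open>The iterates \<open>(T ^^ i) f\<close> with \<open>i \<le> card V\<close> are dependent
  on \<open>V\<close>; the coefficients of a dependence are those of \<open>p\<close>.\<close>

lemma annihilating_poly_exists: "\<exists>p. p \<noteq> 0 \<and> (\<forall>v\<in>V. poly_op p f v = 0)"
proof -
  obtain c i where c: "i \<le> card V" "c i \<noteq> 0" "\<forall>v\<in>V. (\<Sum>i\<le>card V. c i * (T ^^ i) f v) = 0"
    using linear_dependence[OF finite_V, of "\<lambda>i. (T ^^ i) f"] by blast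
  define p where "p = (\<Sum>i\<le>card V. Polynomial.monom (c i) i)"
  have "Polynomial.coeff p i = c i"
    unfolding p_def using c(1) by (simp add: coeff_sum)
  then have "p \<noteq> 0" using c(2) by auto
  moreover have "\<forall>v\<in>V. poly_op p f v = 0"
    unfolding p_def using c(3) by (simp add: poly_op_sum_monom)
  ultimately show ?thesis by blast
qed

text \<open>Self-adjointness moves every \<open>T\<close> onto \<open>z\<close>, where it acts as
  the scalar \<open>\<mu>\<close>.\<close>

lemma inner_poly_op_eigenfunction:
  assumes "\<forall>v\<in>V. T z v = \<mu> * z v"
  shows "(\<Sum>v\<in>V. z v * poly_op p f v) = poly p \<mu> * (\<Sum>v\<in>V. z v * f v)"
proof (induction p)
  case (pCons a p)
  have "(\<Sum>v\<in>V. z v * T (poly_op p f) v) = (\<Sum>v\<in>V. T z v * poly_op p f v)"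
    by (rule self_adjoint)
  also have "\<dots> = \<mu> * (\<Sum>v\<in>V. z v * poly_op p f v)"
    using assms by (simp add: sum_distrib_left mult.assoc)
  finally have "(\<Sum>v\<in>V. z v * T (poly_op p f) v) = \<mu> * (\<Sum>v\<in>V. z v * poly_op p f v)" .
  moreover have "(\<Sum>v\<in>V. z v * poly_op (pCons a p) f v)
      = a * (\<Sum>v\<in>V. z v * f v) + (\<Sum>v\<in>V. z v * T (poly_op p f) v)"
    by (simp add: poly_op_pCons distrib_left sum.distrib sum_distrib_left mult.left_commute)
  ultimately show ?case using pCons by (simp add: algebra_simps)
qed simp

lemma inner_self_eq_0: "(\<Sum>v\<in>V. z v * z v) = 0 \<longleftrightarrow> (\<forall>v\<in>V. z v = (0::real))"
  using finite_V by (subst sum_nonneg_eq_0_iff) auto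

text \<open>The quadratic is \<open>(t - a)^2 + b^2\<close>. With \<open>w = (T - a) z\<close>
  self-adjointness gives \<open>\<langle>w, w\<rangle> = - b^2 \<langle>z, z\<rangle>\<close>, so
  both squared norms vanish.\<close>

lemma no_complex_eigenvalue:
  assumes "b \<noteq> 0" and "\<forall>v\<in>V. poly_op [:a\<^sup>2 + b\<^sup>2, - 2 * a, 1:] z v = 0"
  shows "\<forall>v\<in>V. z v = 0"
proof -
  define w where "w = poly_op [:- a, 1:] z"
  have w: "w v = T z v - a * z v" for v
    by (simp add: w_def poly_op_pCons op_zero)
  have "[:a\<^sup>2 + b\<^sup>2, - 2 * a, 1:] = [:- a, 1:] * [:- a, 1:] + [:b\<^sup>2:]"
    by (simp add: power2_eq_square)
  then have "poly_op [:a\<^sup>2 + b\<^sup>2, - 2 * a, 1:] z = (\<lambda>v. poly_op [:- a, 1:] w v + b\<^sup>2 * z v)"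
    by (simp only: poly_op_add poly_op_mult w_def[symmetric]) (simp add: poly_op_pCons op_zero)
  then have eq: "T w v = a * w v - b\<^sup>2 * z v" if "v \<in> V" for v
    using assms(2) that by (simp add: poly_op_pCons op_zero) (smt (verit))
  have "(\<Sum>v\<in>V. w v * w v) = (\<Sum>v\<in>V. T z v * w v) - a * (\<Sum>v\<in>V. z v * w v)"
    by (simp add: w algebra_simps sum.distrib sum_subtractf sum_distrib_left)
  also have "(\<Sum>v\<in>V. T z v * w v) = (\<Sum>v\<in>V. z v * T w v)"
    by (rule self_adjoint[symmetric])
  also have "\<dots> = (\<Sum>v\<in>V. a * (z v * w v) - b\<^sup>2 * (z v * z v))"
    by (rule sum.cong) (simp_all add: eq algebra_simps)
  also have "\<dots> = a * (\<Sum>v\<in>V. z v * w v) - b\<^sup>2 * (\<Sum>v\<in>V. z v * z v)"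
    by (simp add: sum_subtractf sum_distrib_left)
  finally have "(\<Sum>v\<in>V. w v * w v) = - (b\<^sup>2 * (\<Sum>v\<in>V. z v * z v))" by simp
  moreover have "(\<Sum>v\<in>V. w v * w v) \<ge> 0" "(\<Sum>v\<in>V. z v * z v) \<ge> 0"
    by (auto intro!: sum_nonneg)
  moreover have "b\<^sup>2 > 0" using assms(1) by simp
  ultimately have "(\<Sum>v\<in>V. z v * z v) = 0"
    by (smt (verit) mult_pos_pos)
  then show ?thesis by (simp add: inner_self_eq_0)
qed

text \<open>
  If \<open>h(T) g \<noteq> 0\<close>, take \<open>p\<close> of minimal degree with \<open>p(T) h(T) g = 0\<close>.  Self-adjointness makes a
  complex root \<open>\<mu>\<close> of \<open>p\<close> real, and \<open>z = (p / (t - \<mu>))(T) h(T) g\<close> is an eigenvector for \<open>\<mu>\<close> with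
  \<open>\<langle>z, z\<rangle> = (p / (t - \<mu>))(\<mu>) h(\<mu>) \<langle>z, g\<rangle>\<close>.
\<close>

lemma poly_op_vanishes:
  assumes "\<And>\<mu> z. \<lbrakk>\<forall>v\<in>V. T z v = \<mu> * z v; (\<Sum>v\<in>V. z v * g v) \<noteq> 0\<rbrakk> \<Longrightarrow> poly h \<mu> = 0"
  shows "\<forall>v\<in>V. poly_op h g v = 0"
proof (rule ccontr)
  assume y: "\<not> ?thesis"
  define y where "y = poly_op h g"
  define P where "P = (\<lambda>p. p \<noteq> 0 \<and> (\<forall>v\<in>V. poly_op p y v = 0))"
  obtain p where p: "P p" and min: "\<And>q. P q \<Longrightarrow> degree p \<le> degree q"
    using annihilating_poly_exists[of y] ex_has_least_nat[of P _ degree] unfolding P_def by blast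
  have "degree p \<noteq> 0"
  proof
    assume "degree p = 0"
    then obtain c where "p = [:c:]" by (rule degree_eq_zeroE)
    with p y show False by (auto simp: P_def y_def poly_op_pCons op_zero)
  qed
  then have "\<not> constant (poly (map_poly of_real p :: complex poly))"
    by (simp add: constant_degree)
  then obtain \<zeta> :: complex where \<zeta>: "poly (map_poly of_real p) \<zeta> = 0"
    using fundamental_theorem_of_algebra by blast
  \<comment> \<open>By minimality of \<open>p\<close>, a proper factor \<open>q\<close> of
    \<open>p\<close> cannot annihilate \<open>y\<close>.\<close>
  have *: "\<forall>v\<in>V. poly_op r (poly_op q y) v = 0" "\<exists>v\<in>V. poly_op q y v \<noteq> 0"
    if "p = r * q" "degree r \<noteq> 0" for r q
  proof -
    show "\<forall>v\<in>V. poly_op r (poly_op q y) v = 0"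
      using p that(1) by (simp add: P_def poly_op_mult)
    have "r \<noteq> 0" "q \<noteq> 0" using p that by (auto simp: P_def)
    then have "degree q < degree p" using that by (simp add: degree_mult_eq)
    then show "\<exists>v\<in>V. poly_op q y v \<noteq> 0" using min[of q] \<open>q \<noteq> 0\<close> by (auto simp: P_def)
  qed
  have "Im \<zeta> = 0"
  proof (rule ccontr)
    assume im: "Im \<zeta> \<noteq> 0"
    \<comment> \<open>The minimal polynomial of a non-real \<open>\<zeta>\<close> over the reals.
      The remainder of \<open>p\<close> modulo \<open>s\<close> is at most linear and vanishes at
      \<open>\<zeta>\<close>, hence is zero, and \<open>s\<close> divides \<open>p\<close>.\<close>
    define s where "s = [:(Re \<zeta>)\<^sup>2 + (Im \<zeta>)\<^sup>2, - 2 * Re \<zeta>, 1:]"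
    have s: "poly (map_poly of_real s) \<zeta> = 0"
      by (simp add: s_def complex_eq_iff power2_eq_square algebra_simps)
    have "degree (p mod s) < 2"
      using degree_mod_less'[of s p] by (cases "p mod s = 0") (auto simp: s_def)
    then obtain c d where cd: "p mod s = [:c, d:]"
      by (metis One_nat_def Suc_1 degree_eq_zeroE degree_pCons_eq_if less_Suc_eq_le le_zero_eq
          not_less_eq_eq pCons_cases pCons_0_0 )
    have "p = p div s * s + p mod s" by simp
    then have "poly (map_poly of_real (p mod s)) \<zeta> = 0"
      using \<zeta> s by (metis poly_of_real_add poly_of_real_mult add_0 mult_zero_right)
    then have "c = 0 \<and> d = 0"
      using im by (auto simp: cd poly_of_real_pCons complex_eq_iff)
    then have "p = s * (p div s)" using cd by (metis div_mult_mod_eq add.right_neutral pCons_0_0 mult.commute)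
    from *[OF this] no_complex_eigenvalue[OF im] show False
      by (auto simp: s_def)
  qed
  then obtain \<mu> where "\<zeta> = of_real \<mu>" by (metis complex_is_Real_iff Reals_cases)
  with \<zeta> have "poly p \<mu> = 0" by simp
  then obtain q where q: "p = [:- \<mu>, 1:] * q" by (metis poly_eq_0_iff_dvd dvdE)
  define z where "z = poly_op q y"
  have Tz: "\<forall>v\<in>V. T z v = \<mu> * z v" and z: "\<exists>v\<in>V. z v \<noteq> 0"
    using *[OF q] by (simp_all add: z_def poly_op_pCons op_zero)
  have "(\<Sum>v\<in>V. z v * z v) = poly (q * h) \<mu> * (\<Sum>v\<in>V. z v * g v)"
    using inner_poly_op_eigenfunction[OF Tz, of "q * h" g] by (simp add: poly_op_mult z_def y_def)
  moreover have "(\<Sum>v\<in>V. z v * z v) \<noteq> 0" using z inner_self_eq_0 by blast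
  ultimately show False using assms[OF Tz] by auto
qed

end

section \<open>The signless Laplacian on functions of the vertices\<close>

definition neighbours :: "('a, 'b) pre_digraph \<Rightarrow> 'a \<Rightarrow> 'a set" where
  "neighbours G v = {w. v \<rightarrow>\<^bsub>G\<^esub> w}"

definition signless_op :: "('a, 'b) pre_digraph \<Rightarrow> ('a \<Rightarrow> real) \<Rightarrow> 'a \<Rightarrow> real" where
  "signless_op G f v = real (card (neighbours G v)) * f v + (\<Sum>w\<in>neighbours G v. f w)"

text \<open>The main eigenvalues without an enumeration of the vertices. A nonzero sum already makes
  \<open>f\<close> a nonzero function on the vertices.\<close>

definition main_spectrum :: "('a, 'b) pre_digraph \<Rightarrow> real set" where
  "main_spectrum G =
     {\<theta>. \<exists>f. (\<forall>v\<in>verts G. signless_op G f v = \<theta> * f v) \<and> (\<Sum>v\<in>verts G. f v) \<noteq> 0}"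

lemma main_spectrumI:
  "\<lbrakk>\<And>v. v \<in> verts G \<Longrightarrow> signless_op G f v = \<theta> * f v; (\<Sum>v\<in>verts G. f v) \<noteq> 0\<rbrakk>
    \<Longrightarrow> \<theta> \<in> main_spectrum G"
  unfolding main_spectrum_def by blast

lemma main_spectrumE:
  assumes "\<theta> \<in> main_spectrum G"
  obtains f where "\<And>v. v \<in> verts G \<Longrightarrow> signless_op G f v = \<theta> * f v" "(\<Sum>v\<in>verts G. f v) \<noteq> 0"
  using assms unfolding main_spectrum_def by blast

lemma sum_nth_distinct:
  assumes "distinct vs"
  shows "(\<Sum>i<length vs. g (vs ! i)) = (\<Sum>v\<in>set vs. g v)"
  by (rule sum.reindex_bij_betw) (rule bij_betw_nth[OF assms], auto)

context graph
begin

lemma neighbours_subset: "neighbours G v \<subseteq> verts G"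
  by (auto simp: neighbours_def dest: adj_in_verts)

lemma finite_neighbours [simp]: "finite (neighbours G v)"
  using neighbours_subset finite_verts by (rule finite_subset)

lemma neighbours_sym: "w \<in> neighbours G v \<longleftrightarrow> v \<in> neighbours G w"
  by (auto simp: neighbours_def intro: graph_symmetric)

lemma not_self_neighbour: "v \<notin> neighbours G v"
  by (auto simp: neighbours_def dest: adj_not_same)

text \<open>Since there are no parallel arcs, \<open>head G\<close> is injective on the arcs leaving
  \<open>v\<close>.\<close>

lemma out_degree_eq_card_neighbours: "out_degree G v = card (neighbours G v)"
proof -
  have "bij_betw (head G) (out_arcs G v) (neighbours G v)"
    unfolding bij_betw_def
  proof
    show "inj_on (head G) (out_arcs G v)"
      by (rule inj_onI) (auto intro!: no_multi_arcs simp: arc_to_ends_def)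
    show "head G ` out_arcs G v = neighbours G v"
      by (auto simp: neighbours_def arcs_ends_conv)
  qed
  then show ?thesis unfolding out_degree_def by (rule bij_betw_same_card)
qed

lemma signless_laplacian_mult_vec:
  assumes vs: "distinct vs" "set vs = verts G"
    and x: "x \<in> carrier_vec (length vs)" "\<And>j. j < length vs \<Longrightarrow> f (vs ! j) = x $ j"
    and i: "i < length vs"
  shows "(signless_laplacian G vs *\<^sub>v x) $ i = signless_op G f (vs ! i)"
proof -
  let ?n = "length vs" and ?v = "vs ! i"
  have Q: "signless_laplacian G vs \<in> carrier_mat ?n ?n"
    by (simp add: signless_laplacian_def degree_mat_def adjacency_mat_def)
  have "(signless_laplacian G vs *\<^sub>v x) $ i = (\<Sum>j<?n. signless_laplacian G vs $$ (i, j) * x $ j)"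
    using Q x(1) i by (auto simp: scalar_prod_def atLeast0LessThan intro!: sum.cong)
  also have "\<dots> = (\<Sum>j<?n. (if i = j then real (card (neighbours G ?v)) * f ?v else 0)
      + (if vs ! j \<in> neighbours G ?v then f (vs ! j) else 0))"
    using i x(2) by (intro sum.cong)
      (auto simp: signless_laplacian_def degree_mat_def adjacency_mat_def neighbours_def
        out_degree_eq_card_neighbours[unfolded neighbours_def] algebra_simps)
  also have "\<dots> = real (card (neighbours G ?v)) * f ?v
      + (\<Sum>w\<in>verts G. if w \<in> neighbours G ?v then f w else 0)"
    using i sum_nth_distinct[OF vs(1), of "\<lambda>w. if w \<in> neighbours G ?v then f w else 0"] vs(2)
    by (simp add: sum.distrib)
  also have "(\<Sum>w\<in>verts G. if w \<in> neighbours G ?v then f w else 0) = (\<Sum>w\<in>neighbours G ?v. f w)"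
    using neighbours_subset[of ?v]
    by (subst sum.inter_restrict[symmetric]) (auto simp: Int_absorb1)
  finally show ?thesis by (simp add: signless_op_def)
qed

lemma main_signless_laplacian_eigenvalue_iff:
  assumes vs: "distinct vs" "set vs = verts G"
  shows "main_signless_laplacian_eigenvalue G vs \<theta> \<longleftrightarrow> \<theta> \<in> main_spectrum G"
proof
  let ?n = "length vs" and ?Q = "signless_laplacian G vs"
  have Q: "dim_row ?Q = ?n" "dim_col ?Q = ?n"
    by (simp_all add: signless_laplacian_def degree_mat_def adjacency_mat_def)
  {
    assume "main_signless_laplacian_eigenvalue G vs \<theta>"
    then obtain x where x: "x \<in> carrier_vec ?n" "?Q *\<^sub>v x = \<theta> \<cdot>\<^sub>v x" "(\<Sum>i<?n. x $ i) \<noteq> 0"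
      unfolding main_signless_laplacian_eigenvalue_def eigenvector_def using Q by auto
    \<comment> \<open>Reads the entry of \<open>x\<close> at the position of \<open>v\<close>, which
      is unique because \<open>vs\<close> is distinct.\<close>
    define f where "f v = x $ (inv_into {..<?n} ((!) vs) v)" for v
    have f: "f (vs ! j) = x $ j" if "j < ?n" for j
      using inv_into_f_f[of "(!) vs" "{..<?n}" j] inj_on_nth[OF vs(1), of "{..<?n}"] that
      by (simp add: f_def)
    show "\<theta> \<in> main_spectrum G"
    proof (rule main_spectrumI)
      fix v assume "v \<in> verts G"
      then obtain i where "i < ?n" "v = vs ! i" using vs by (metis in_set_conv_nth)
      then show "signless_op G f v = \<theta> * f v"
        using signless_laplacian_mult_vec[OF vs x(1) f] x(1,2) f by auto
    next
      have "(\<Sum>v\<in>verts G. f v) = (\<Sum>i<?n. x $ i)"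
        using sum_nth_distinct[OF vs(1), of f] vs(2) f by simp
      with x(3) show "(\<Sum>v\<in>verts G. f v) \<noteq> 0" by simp
    qed
  next
    assume "\<theta> \<in> main_spectrum G"
    then obtain f where f: "\<And>v. v \<in> verts G \<Longrightarrow> signless_op G f v = \<theta> * f v" "(\<Sum>v\<in>verts G. f v) \<noteq> 0"
      by (rule main_spectrumE) blast
    define x where "x = vec ?n (\<lambda>i. f (vs ! i))"
    have x: "x \<in> carrier_vec ?n" "\<And>j. j < ?n \<Longrightarrow> f (vs ! j) = x $ j"
      by (simp_all add: x_def)
    have sum: "(\<Sum>i<?n. x $ i) \<noteq> 0"
      using sum_nth_distinct[OF vs(1), of f] vs(2) f(2) x(2) by simp
    then have "x \<noteq> 0\<^sub>v ?n" by auto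
    moreover have "?Q *\<^sub>v x = \<theta> \<cdot>\<^sub>v x"
    proof (rule eq_vecI)
      fix i assume "i < dim_vec (\<theta> \<cdot>\<^sub>v x)"
      then have i: "i < ?n" using x(1) by simp
      then show "(?Q *\<^sub>v x) $ i = (\<theta> \<cdot>\<^sub>v x) $ i"
        using signless_laplacian_mult_vec[OF vs x i] f(1)[of "vs ! i"] vs(2) x nth_mem[OF i] by simp
    qed (use x(1) Q in auto)
    ultimately show "main_signless_laplacian_eigenvalue G vs \<theta>"
      unfolding main_signless_laplacian_eigenvalue_def eigenvector_def using x(1) sum Q by auto
  }
qed

lemma self_adjoint_signless_op: "self_adjoint_operator (verts G) (signless_op G)"
proof
  show "signless_op G (\<lambda>v. a * f v + b * g v) = (\<lambda>v. a * signless_op G f v + b * signless_op G g v)"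
    for a b f g
    by (simp add: signless_op_def fun_eq_iff sum.distrib sum_distrib_left algebra_simps)
  show "(\<Sum>v\<in>verts G. f v * signless_op G g v) = (\<Sum>v\<in>verts G. signless_op G f v * g v)" for f g
  proof -
    \<comment> \<open>Both forms describe the same set by symmetry of adjacency; exchanging the
      order of summation turns one into the other.\<close>
    have N: "neighbours G v = {w \<in> verts G. v \<rightarrow>\<^bsub>G\<^esub> w}" "neighbours G v = {w \<in> verts G. w \<rightarrow>\<^bsub>G\<^esub> v}" for v
      by (auto simp: neighbours_def dest: adj_in_verts intro: graph_symmetric)
    have "(\<Sum>v\<in>verts G. \<Sum>w\<in>neighbours G v. f v * g w) = (\<Sum>w\<in>verts G. \<Sum>v\<in>neighbours G w. f v * g w)"
      unfolding N(1) by (subst sum.swap_restrict) (auto simp: N[symmetric])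
    then show ?thesis
      by (simp add: signless_op_def distrib_left distrib_right sum.distrib sum_distrib_left
          sum_distrib_right algebra_simps)
  qed
qed (rule finite_verts)

text \<open>
  This is \<open>(Q - \<theta>\<^sub>1)(Q - \<theta>\<^sub>2) j = 0\<close> for the all-ones vector \<open>j\<close>, since \<open>Q j = 2 d\<close>.
\<close>

lemma degree_equation:
  assumes "main_spectrum G \<subseteq> {\<theta>\<^sub>1, \<theta>\<^sub>2}"
  obtains a b where "\<And>v. v \<in> verts G \<Longrightarrow> (\<Sum>w\<in>neighbours G v. real (card (neighbours G w)))
    = a * real (card (neighbours G v)) - (real (card (neighbours G v)))\<^sup>2 + b"
proof -
  interpret self_adjoint_operator "verts G" "signless_op G" by (rule self_adjoint_signless_op)
  let ?d = "\<lambda>v. real (card (neighbours G v))"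
  define h where "h = [:\<theta>\<^sub>1 * \<theta>\<^sub>2, - (\<theta>\<^sub>1 + \<theta>\<^sub>2), 1:]"
  have one: "signless_op G (\<lambda>_. c) v = 2 * c * ?d v" for c v by (simp add: signless_op_def)
  have "\<forall>v\<in>verts G. poly_op h (\<lambda>_. 1) v = 0"
  proof (rule poly_op_vanishes)
    fix \<theta> z assume "\<forall>v\<in>verts G. signless_op G z v = \<theta> * z v" "(\<Sum>v\<in>verts G. z v * 1) \<noteq> 0"
    then have "\<theta> \<in> main_spectrum G" by (intro main_spectrumI) auto
    with assms have "\<theta> = \<theta>\<^sub>1 \<or> \<theta> = \<theta>\<^sub>2" by auto
    then show "poly h \<theta> = 0" by (auto simp: h_def algebra_simps)
  qed
  \<comment> \<open>Horner form of \<open>h(Q) j\<close>, with the inner \<open>Q j\<close> already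
    replaced by \<open>2 d\<close>. Halving it gives
    \<open>a = \<theta>\<^sub>1 + \<theta>\<^sub>2\<close> and
    \<open>b = - \<theta>\<^sub>1 * \<theta>\<^sub>2 / 2\<close>.\<close>
  then have *: "\<theta>\<^sub>1 * \<theta>\<^sub>2 + signless_op G (\<lambda>v. 2 * ?d v - (\<theta>\<^sub>1 + \<theta>\<^sub>2)) v = 0" if "v \<in> verts G" for v
    using that by (simp add: h_def poly_op_pCons op_zero one algebra_simps)
  have "(\<Sum>w\<in>neighbours G v. ?d w) = (\<theta>\<^sub>1 + \<theta>\<^sub>2) * ?d v - (?d v)\<^sup>2 + (- \<theta>\<^sub>1 * \<theta>\<^sub>2 / 2)"
    if "v \<in> verts G" for v
    using *[OF that] by (simp add: signless_op_def sum_subtractf sum_distrib_left[symmetric]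
        power2_eq_square algebra_simps)
  with that show thesis by blast
qed

end

section \<open>Longest paths in trees\<close>

locale tree_graph = graph +
  assumes connected: "connected G"
    and acyclic: "\<lbrakk>cycle p; 3 \<le> length p\<rbrakk> \<Longrightarrow> False"
begin

text \<open>Induction along walks from a member of \<open>A\<close>. It serves to show that the
  vertices found so far exhaust a connected graph.\<close>

lemma closed_set_eq_verts:
  assumes "A \<subseteq> verts G" "A \<noteq> {}" "\<And>v. v \<in> A \<Longrightarrow> neighbours G v \<subseteq> A"
  shows "verts G = A"
proof -
  obtain u where u: "u \<in> A" using assms(2) by blast
  have "v \<in> A" if "v \<in> verts G" for v
  proof -
    have "u \<rightarrow>\<^sup>*\<^bsub>mk_symmetric G\<^esub> v"
      using connected u assms(1) that unfolding connected_def by (auto simp: strongly_connected_def)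
    then have "u \<rightarrow>\<^sup>* v" using reachable_mk_symmetric_eq sym_arcs by blast
    then show ?thesis
      by (induction rule: reachable_induct) (use u assms(3) in \<open>auto simp: neighbours_def\<close>)
  qed
  with assms(1) show ?thesis by blast
qed

text \<open>Paths are vertex lists, so that reversing a path or exchanging its end is a list
  operation.\<close>

definition vpath :: "'a list \<Rightarrow> bool" where
  "vpath xs \<longleftrightarrow> distinct xs \<and> set xs \<subseteq> verts G \<and> successively (\<lambda>v w. v \<rightarrow>\<^bsub>G\<^esub> w) xs"

definition longest_vpath :: "'a list \<Rightarrow> bool" where
  "longest_vpath xs \<longleftrightarrow> vpath xs \<and> (\<forall>ys. vpath ys \<longrightarrow> length ys \<le> length xs)"

text \<open>Supplies the arcs along a vertex list, since \<open>cycle\<close> speaks of arc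
  lists.\<close>

lemma awalk_of_successively:
  assumes "successively (\<lambda>v w. v \<rightarrow>\<^bsub>G\<^esub> w) (x # ys)" "x \<in> verts G"
  shows "\<exists>p. awalk x p (last (x # ys)) \<and> awalk_verts x p = x # ys"
  using assms
proof (induction ys arbitrary: x)
  case Nil
  then show ?case by (intro exI[of _ "[]"]) (simp add: awalk_Nil_iff)
next
  case (Cons y ys)
  then have "x \<rightarrow>\<^bsub>G\<^esub> y" by simp
  then obtain e where e: "e \<in> arcs G" "tail G e = x" "head G e = y" by auto
  obtain p where "awalk y p (last (y # ys))" "awalk_verts y p = y # ys"
    using Cons e(1,3) head_in_verts[OF e(1)] by auto
  with e show ?case by (intro exI[of _ "e # p"]) (simp add: awalk_Cons_iff)
qed

text \<open>If \<open>w\<close> lay in \<open>r\<close>, the edge from \<open>w\<close> to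
  \<open>x\<close> would close the segment from \<open>x\<close> through \<open>y\<close> to
  \<open>w\<close> into a cycle of length at least three.\<close>

lemma vpath_Cons:
  assumes path: "vpath (x # y # r)" and w: "w \<in> neighbours G x" "w \<noteq> y"
  shows "vpath (w # x # y # r)"
proof -
  have wx: "w \<rightarrow>\<^bsub>G\<^esub> x" using w(1) by (auto simp: neighbours_def intro: graph_symmetric)
  have "w \<notin> set r"
  proof
    assume "w \<in> set r"
    then obtain r1 r2 where r: "r = r1 @ w # r2" by (auto simp: in_set_conv_decomp)
    define q where "q = y # r1 @ [w]"
    have "successively (\<lambda>v w. v \<rightarrow>\<^bsub>G\<^esub> w) (x # q)" and x: "x \<in> verts G" and dist: "distinct (x # q)"
      using path unfolding vpath_def r q_def by (auto simp: successively_append_iff successively_Cons hd_append)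
    then obtain p where p: "awalk x p w" "awalk_verts x p = x # q"
      using awalk_of_successively[of x q] by (auto simp: q_def)
    obtain e where e: "e \<in> arcs G" "tail G e = w" "head G e = x" using wx by auto
    have "cycle (e # p)"
      unfolding cycle_def using e p dist by (intro exI[of _ w]) (simp add: awalk_Cons_iff)
    moreover have "length p = length q"
      using length_awalk_verts[of x p] p(2) by simp
    ultimately show False using acyclic[of "e # p"] by (simp add: q_def)
  qed
  moreover have "w \<noteq> x" using w(1) not_self_neighbour by auto
  moreover have "w \<in> verts G" using w(1) neighbours_subset by auto
  ultimately show ?thesis using path w wx unfolding vpath_def by auto
qed

lemma longest_vpath_exists:
  assumes "verts G \<noteq> {}"
  obtains xs where "longest_vpath xs"
proof -
  obtain v where "v \<in> verts G" using assms by blast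
  then have "vpath [v]" by (simp add: vpath_def)
  moreover have "\<forall>xs. vpath xs \<longrightarrow> length xs < Suc (card (verts G))"
    unfolding vpath_def using card_mono[OF finite_verts] distinct_card le_imp_less_Suc by metis
  ultimately obtain xs where "vpath xs" "\<And>ys. vpath ys \<Longrightarrow> length ys \<le> length xs"
    using ex_has_greatest_nat[of vpath "[v]" length] by blast
  with that show thesis unfolding longest_vpath_def by blast
qed

lemma longest_vpath_rev: "longest_vpath xs \<Longrightarrow> longest_vpath (rev xs)"
  by (auto simp: longest_vpath_def vpath_def elim!: successively_mono
      intro: graph_symmetric)

lemma longest_vpathI: "\<lbrakk>longest_vpath xs; vpath ys; length ys = length xs\<rbrakk> \<Longrightarrow> longest_vpath ys"
  by (simp add: longest_vpath_def)

text \<open>Any other neighbour of the end \<open>x\<close> could be put in front of the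
  path.\<close>

lemma longest_vpath_hd:
  assumes "longest_vpath (x # y # r)"
  shows "neighbours G x = {y}"
proof -
  have "y \<in> neighbours G x" using assms by (simp add: longest_vpath_def vpath_def neighbours_def)
  moreover have "w = y" if "w \<in> neighbours G x" for w
  proof (rule ccontr)
    assume "w \<noteq> y"
    then have "vpath (w # x # y # r)"
      using assms that by (intro vpath_Cons) (auto simp: longest_vpath_def)
    with assms have "length (w # x # y # r) \<le> length (x # y # r)" unfolding longest_vpath_def by blast
    then show False by simp
  qed
  ultimately show ?thesis by blast
qed

lemma vpath_tl: "vpath (x # xs) \<Longrightarrow> vpath xs"
  by (auto simp: vpath_def successively_Cons)

lemma longest_vpath_change1:
  assumes "longest_vpath (x # y # z # r)" "w \<in> neighbours G y" "w \<noteq> z"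
  shows "longest_vpath (w # y # z # r)"
  using assms vpath_Cons[of y z r w] vpath_tl[of x "y # z # r"]
  by (intro longest_vpathI[OF assms(1)]) (auto simp: longest_vpath_def)

text \<open>Two steps into another branch at \<open>z\<close> replace \<open>x\<close> and
  \<open>y\<close> without changing the length, so the new end \<open>w'\<close> is a leaf as
  well.\<close>

lemma longest_vpath_change2:
  assumes "longest_vpath (x # y # z # u # r)" "w \<in> neighbours G z" "w \<noteq> u"
    and "w' \<in> neighbours G w" "w' \<noteq> z"
  shows "longest_vpath (w' # w # z # u # r)"
proof -
  have "vpath (z # u # r)" using assms(1) vpath_tl unfolding longest_vpath_def by blast
  then have "vpath (w' # w # z # u # r)" using assms(2-) by (intro vpath_Cons)
  then show ?thesis by (rule longest_vpathI[OF assms(1)]) simp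
qed

end

section \<open>Trees with two main eigenvalues\<close>

lemma (in graph) complete_bipartite_1I:
  assumes "verts G = insert c L" "c \<notin> L" "neighbours G c = L"
    and "\<And>l. l \<in> L \<Longrightarrow> neighbours G l = {c}"
  shows "K\<^bsub>1, card (verts G) - 1\<^esub> G"
proof -
  have "finite L" using finite_verts assms(1) by simp
  have "arcs_ends G = {c} \<times> L \<union> L \<times> {c}"
  proof (intro Set.set_eqI iffI)
    fix e assume e: "e \<in> arcs_ends G"
    obtain x y where xy: "e = (x, y)" by force
    then have "x \<in> verts G" "y \<in> neighbours G x"
      using e adj_in_verts by (auto simp: neighbours_def)
    then show "e \<in> {c} \<times> L \<union> L \<times> {c}" using assms xy by auto
  next
    fix e assume "e \<in> {c} \<times> L \<union> L \<times> {c}"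
    then obtain x y where "e = (x, y)" "y \<in> neighbours G x" using assms by auto
    then show "e \<in> arcs_ends G" by (simp add: neighbours_def)
  qed
  then have "verts G = {c} \<union> L \<and> {c} \<inter> L = {} \<and> card {c} = 1 \<and> card L = card (verts G) - 1
      \<and> arcs_ends G = {c} \<times> L \<union> L \<times> {c}"
    using assms(1,2) \<open>finite L\<close> by simp
  then show ?thesis
    unfolding complete_bipartite_digraph_def using graph_axioms by blast
qed

lemma (in graph) double_starI:
  assumes "verts G = {u, v} \<union> L \<union> M" "u \<noteq> v" "u \<notin> L \<union> M" "v \<notin> L \<union> M" "L \<inter> M = {}"
    and "neighbours G u = insert v L" "neighbours G v = insert u M"
    and "\<And>l. l \<in> L \<Longrightarrow> neighbours G l = {u}" "\<And>m. m \<in> M \<Longrightarrow> neighbours G m = {v}"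
  shows "double_star (card L + 1) (card M + 1) G"
proof -
  have "arcs_ends G = ({(u, v)} \<union> {u} \<times> L \<union> {v} \<times> M)\<^sup>s" (is "_ = ?R")
  proof (intro Set.set_eqI iffI)
    fix e assume e: "e \<in> arcs_ends G"
    obtain x y where xy: "e = (x, y)" by force
    then have x: "x \<in> verts G" and y: "y \<in> neighbours G x"
      using e adj_in_verts by (auto simp: neighbours_def)
    from x assms(1) consider "x = u" | "x = v" | "x \<in> L" | "x \<in> M" by blast
    then show "e \<in> ?R"
      using y by cases (auto simp: xy symcl_def assms(6-9))
  next
    fix e assume "e \<in> ?R"
    then obtain x y where e: "e = (x, y)"
      and "x = u \<and> y \<in> insert v L \<or> x = v \<and> y \<in> insert u M \<or> x \<in> L \<and> y = u \<or> x \<in> M \<and> y = v"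
      unfolding symcl_def by auto
    then have "y \<in> neighbours G x" using assms(6-9) by blast
    then show "e \<in> arcs_ends G" by (simp add: e neighbours_def)
  qed
  then show ?thesis
    unfolding double_star_def using assms(1-5) graph_axioms by blast
qed

text \<open>
  With \<open>K = k - 1\<close>, \<open>S = s - 1\<close> and the integer \<open>m = t - k + S (S + 1)\<close> the equations give
  \<open>K m = S\<^sup>2\<close>, hence \<open>m \<ge> 1\<close>, whereas \<open>t \<ge> 2\<close> amounts to \<open>(K - 1) (m - 1) + S \<le> 0\<close>.
\<close>

lemma degree_equations_inconsistent:
  fixes k s t :: nat and a b :: real
  assumes k: "k \<ge> 2" and s: "s \<ge> 2" and t: "t \<ge> 2"
    and "real k = a - 1 + b"
    and "real (k - 1) + real s = a * real k - (real k)\<^sup>2 + b"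
    and "real (s - 1) * real k + real t = a * real s - (real s)\<^sup>2 + b"
  shows False
proof -
  define K S m where "K = int k - 1" and "S = int s - 1" and "m = int t - int k + S * (S + 1)"
  have b: "b = real k + 1 - a" using assms(4) by simp
  have KS: "real_of_int K = real k - 1" "real_of_int S = real s - 1"
    by (simp_all add: K_def S_def)
  have 1: "real_of_int K * (a - real k - 1) = real_of_int S"
    using assms(5) k by (simp add: b KS of_nat_diff power2_eq_square algebra_simps)
  have 2: "real_of_int m = real_of_int S * (a - real k - 1)"
    using assms(6) s by (simp add: m_def b KS of_nat_diff power2_eq_square algebra_simps)
  \<comment> \<open>Eliminates the common factor \<open>a - real k - 1\<close>; what remains is an
    equation between integers.\<close>
  have "real_of_int (K * m) = real_of_int (S * S)"
    using 1 2 by (simp add: mult.left_commute)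
  then have eq: "K * m = S * S" by (simp only: of_int_eq_iff)
  have pos: "K \<ge> 1" "S \<ge> 1" using k s by (simp_all add: K_def S_def)
  then have "K * m > 0" unfolding eq by simp
  then have "m \<ge> 1" using pos by (simp add: zero_less_mult_iff)
  then have "(K - 1) * (m - 1) \<ge> 0" using pos by simp
  moreover have "m \<ge> 1 - K + K * m + S"
    unfolding eq using t by (simp add: m_def K_def algebra_simps)
  ultimately show False using pos(2) by (simp add: algebra_simps)
qed

context tree_graph
begin

lemma neighbours_singletonI:
  assumes "card (neighbours G w) = 1" "v \<in> neighbours G w"
  shows "neighbours G w = {v}"
  using assms by (auto simp: card_1_singleton_iff)

text \<open>Connectedness excludes isolated vertices, so a longest path has an edge. Were it a
  single edge, both ends would be leaves and the graph would have two vertices.\<close>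

lemma longest_vpath_length:
  assumes "card (verts G) \<ge> 3" "longest_vpath xs"
  shows "length xs \<ge> 3"
proof (rule ccontr)
  assume short: "\<not> ?thesis"
  have nonempty: "neighbours G v \<noteq> {}" if "v \<in> verts G" for v
  proof
    assume "neighbours G v = {}"
    then have "verts G = {v}" using that by (intro closed_set_eq_verts) auto
    with assms(1) show False by simp
  qed
  obtain v where v: "v \<in> verts G" using assms(1) by fastforce
  then obtain w where "w \<in> neighbours G v" using nonempty by blast
  then have "vpath [v, w]"
    using v neighbours_subset[of v] not_self_neighbour[of v] by (auto simp: vpath_def neighbours_def)
  then have "length [v, w] \<le> length xs" using assms(2) unfolding longest_vpath_def by blast
  with short have "length xs = 2" by (simp add: not_le)
  then obtain x y where xs: "xs = [x, y]"
    by (auto simp: length_Suc_conv numeral_2_eq_2)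
  have "neighbours G x = {y}" "neighbours G y = {x}"
    using longest_vpath_hd[of x y "[]"] longest_vpath_hd[of y x "[]"] longest_vpath_rev[of xs]
      assms(2) xs by auto
  moreover have "x \<in> verts G" "y \<in> verts G"
    using assms(2) xs by (auto simp: longest_vpath_def vpath_def)
  ultimately have "verts G = {x, y}" by (intro closed_set_eq_verts) auto
  then show False using assms(1) card_insert_le_m1[of 2 "{y}" x] by simp
qed

lemma longest_vpath_second:
  assumes "longest_vpath (x # y # z # r)" "w \<in> neighbours G y" "w \<noteq> z"
  shows "neighbours G w = {y}"
  using longest_vpath_change1[OF assms] by (rule longest_vpath_hd)

lemma star_or_double_star:
  assumes n: "card (verts G) \<ge> 3"
    and eq: "\<And>v. v \<in> verts G \<Longrightarrow> (\<Sum>w\<in>neighbours G v. real (card (neighbours G w)))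
      = a * real (card (neighbours G v)) - (real (card (neighbours G v)))\<^sup>2 + b"
  shows "K\<^bsub>1, card (verts G) - 1\<^esub> G \<or>
    even (card (verts G)) \<and> double_star (card (verts G) div 2) (card (verts G) div 2) G"
proof -
  let ?N = "neighbours G" and ?d = "\<lambda>v. card (neighbours G v)"
  have "verts G \<noteq> {}" using n by auto
  then obtain xs where xs: "longest_vpath xs" by (rule longest_vpath_exists)
  with n have "length xs \<ge> 3" by (rule longest_vpath_length)
  then obtain x y z r where "xs = x # y # z # r"
    by (metis Suc_le_length_iff numeral_3_eq_3)
  with xs have path: "longest_vpath (x # y # z # r)" by simp
  then have V: "x \<in> verts G" "y \<in> verts G" "z \<in> verts G" and dist: "distinct (x # y # z # r)"
    and adj: "y \<in> ?N x" "x \<in> ?N y" "z \<in> ?N y" "y \<in> ?N z"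
    by (auto simp: longest_vpath_def vpath_def neighbours_def intro: graph_symmetric)
  note leaf_y = longest_vpath_second[OF path]
  show ?thesis
  proof (cases r)
    case Nil
    \<comment> \<open>Here \<open>z\<close> is an end too, so all neighbours of \<open>y\<close> are
      leaves and \<open>y\<close> is the centre of a star.\<close>
    have "longest_vpath (z # y # x # [])"
      using longest_vpath_rev[OF path] Nil by simp
    then have "?N z = {y}" by (rule longest_vpath_hd)
    then have leaf: "?N w = {y}" if "w \<in> ?N y" for w
      using leaf_y[OF that] by (cases "w = z") auto
    have "verts G = insert y (?N y)"
    proof (rule closed_set_eq_verts)
      show "insert y (?N y) \<subseteq> verts G" using V neighbours_subset by blast
      show "?N v \<subseteq> insert y (?N y)" if "v \<in> insert y (?N y)" for v
        using that leaf by blast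
    qed blast
    then show ?thesis
      using complete_bipartite_1I[of y "?N y"] not_self_neighbour leaf by blast
  next
    case (Cons u r')
    note path = path[unfolded Cons]
    have u: "u \<in> verts G" "u \<in> ?N z" "z \<in> ?N u" "u \<noteq> y" "u \<noteq> z"
      using path by (auto simp: longest_vpath_def vpath_def neighbours_def intro: graph_symmetric)
    define k s t where "k = ?d y" and "s = ?d z" and "t = ?d u"
    have two: "?d v \<ge> 2" if "p \<in> ?N v" "q \<in> ?N v" "p \<noteq> q" for v p q
      using card_mono[of "?N v" "{p, q}"] that by simp
    have k: "k \<ge> 2" and s: "s \<ge> 2"
      unfolding k_def s_def using two[of x y z] two[of y z u] adj u dist by auto
    \<comment> \<open>The degree equation at the leaf \<open>w\<close>, whose left side is the
      degree of \<open>v\<close>. All vertices with a leaf neighbour thus share one degree.\<close>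
    have support: "real (?d v) = a - 1 + b" if "?N w = {v}" for v w
    proof -
      have "w \<in> verts G" using that neighbours_sym[of v w] neighbours_subset by blast
      from eq[OF this] that show ?thesis by simp
    qed
    have k_eq: "real k = a - 1 + b"
      unfolding k_def using support[OF longest_vpath_hd[OF path]] .
    have "(\<Sum>w\<in>?N y - {z}. real (?d w)) = (\<Sum>w\<in>?N y - {z}. 1)"
    proof (rule sum.cong)
      fix w assume "w \<in> ?N y - {z}"
      then have "?N w = {y}" using leaf_y by blast
      then show "real (?d w) = 1" by simp
    qed simp
    also have "\<dots> = real (k - 1)" using adj(3) by (simp add: k_def)
    finally have "(\<Sum>w\<in>?N y. real (?d w)) = real (k - 1) + real s"
      using adj(3) by (simp add: sum.remove[of _ z] s_def)
    then have y_eq: "real (k - 1) + real s = a * real k - (real k)\<^sup>2 + b"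
      using eq[OF V(2)] unfolding k_def by simp
    show ?thesis
    proof (cases "\<exists>w. ?N w = {z}")
      case True
      then have "real s = real k" using support k_eq unfolding s_def by auto
      then have sk: "s = k" by simp
      \<comment> \<open>As \<open>y\<close> and \<open>z\<close> have equal degrees, the right sides
        of their degree equations coincide.\<close>
      have "(\<Sum>w\<in>?N z. real (?d w)) = real (k - 1) + real k"
        using eq[OF V(3)] y_eq sk unfolding s_def by simp
      then have "(\<Sum>w\<in>?N z - {y}. real (?d w)) = real (k - 1)"
        using adj(4) by (simp add: sum.remove[of _ y] k_def)
      also have "\<dots> = (\<Sum>w\<in>?N z - {y}. 1)" using adj(4) by (simp add: sk[symmetric] s_def)
      \<comment> \<open>The degrees are at least one and their sum equals their number, so each of
        them is one.\<close>
      finally have sum: "(\<Sum>w\<in>?N z - {y}. 1) = (\<Sum>w\<in>?N z - {y}. real (?d w))" by simp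
      have z_nbr: "z \<in> ?N w" if "w \<in> ?N z" for w using that neighbours_sym by blast
      have ge1: "1 \<le> real (?d w)" if "w \<in> ?N z - {y}" for w
      proof -
        have "card {z} \<le> ?d w" using z_nbr[of w] that by (intro card_mono) auto
        then show ?thesis by simp
      qed
      have leaf_z: "?N w = {z}" if "w \<in> ?N z - {y}" for w
      proof -
        have "1 = real (?d w)" by (rule sum_mono_inv[OF sum ge1 that]) simp_all
        then have "?d w = 1" by linarith
        then show ?thesis using z_nbr[of w] that by (intro neighbours_singletonI) auto
      qed
      define L M where "L = ?N y - {z}" and "M = ?N z - {y}"
      have L: "?N y = insert z L" and M: "?N z = insert y M"
        unfolding L_def M_def using adj by blast+
      have leaf: "?N l = {y}" if "l \<in> L" for l
        using leaf_y that unfolding L_def by blast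
      have leaf': "?N l = {z}" if "l \<in> M" for l
        using leaf_z that unfolding M_def by blast
      have yz: "y \<noteq> z" using dist by simp
      have card: "card L + 1 = k" "card M + 1 = k"
        using adj k sk by (simp_all add: L_def M_def k_def s_def)
      have disj: "L \<inter> M = {}" using leaf leaf' yz by blast
      have notin: "y \<notin> L \<union> M" "z \<notin> L \<union> M"
        using not_self_neighbour by (auto simp: L_def M_def)
      have fin: "finite L" "finite M" by (simp_all add: L_def M_def)
      have verts: "verts G = {y, z} \<union> L \<union> M"
      proof (rule closed_set_eq_verts)
        have "L \<subseteq> verts G" "M \<subseteq> verts G" unfolding L_def M_def using neighbours_subset by blast+
        then show "{y, z} \<union> L \<union> M \<subseteq> verts G" using V by blast
        show "?N v \<subseteq> {y, z} \<union> L \<union> M" if "v \<in> {y, z} \<union> L \<union> M" for v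
          using that L M leaf leaf' by blast
      qed blast
      have "card (verts G) = 2 + (card L + card M)"
        using verts yz notin disj fin by (simp add: card_Un_disjoint Un_assoc)
      then have "card (verts G) = 2 * k" using card by simp
      moreover have "double_star k k G"
        using double_starI[OF verts yz notin disj L M leaf leaf'] card by simp
      ultimately show ?thesis by simp
    next
      case False
      \<comment> \<open>Since \<open>w\<close> is no leaf, it has a neighbour \<open>w'\<close>
        beyond \<open>z\<close>. This \<open>w'\<close> is the end of a longest path, so
        \<open>w\<close> has a leaf neighbour and degree \<open>k\<close>.\<close>
      have deg: "real (?d w) = real k" if w: "w \<in> ?N z" "w \<noteq> u" for w
      proof -
        have "?N w \<noteq> {z}" using False by blast
        then obtain w' where w': "w' \<in> ?N w" "w' \<noteq> z"
          using w(1) neighbours_sym[of z w] by blast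
        have "?N w' = {w}"
          using longest_vpath_change2[OF path w w'] by (rule longest_vpath_hd)
        then show ?thesis using support k_eq by simp
      qed
      have "(\<Sum>w\<in>?N z. real (?d w)) = real t + (\<Sum>w\<in>?N z - {u}. real k)"
        using u(2) deg by (simp add: sum.remove[of _ u] t_def)
      also have "(\<Sum>w\<in>?N z - {u}. real k) = real (s - 1) * real k"
        using u(2) by (simp add: s_def)
      finally have z_eq: "real (s - 1) * real k + real t = a * real s - (real s)\<^sup>2 + b"
        using eq[OF V(3)] unfolding s_def by simp
      have "?N u \<noteq> {z}" using False by blast
      then obtain q where "q \<in> ?N u" "q \<noteq> z" using u(3) by auto
      then have "t \<ge> 2" unfolding t_def using two[of q u z] u(3) by simp
      from degree_equations_inconsistent[OF k s this k_eq y_eq z_eq] show ?thesis ..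
    qed
  qed
qed

end

section \<open>The main eigenvalues of stars and double stars\<close>

context graph
begin

text \<open>With \<open>S\<close> the sum over the leaves, the centre and the summed leaf equations
  share the left side \<open>?p * f c + S\<close>, whence \<open>\<theta> = 0\<close> or
  \<open>f c = S\<close>.\<close>

lemma main_spectrum_star:
  assumes "verts G = insert c L" "c \<notin> L" "neighbours G c = L"
    and "\<And>l. l \<in> L \<Longrightarrow> neighbours G l = {c}" and "card L \<ge> 2"
  shows "main_spectrum G = {0, real (card L) + 1}"
proof (intro Set.set_eqI iffI)
  let ?p = "real (card L)"
  have fin: "finite L" using assms(5) card.infinite by fastforce
  have op: "signless_op G f c = ?p * f c + (\<Sum>l\<in>L. f l)"
    "\<And>l. l \<in> L \<Longrightarrow> signless_op G f l = f l + f c" for f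
    using assms by (simp_all add: signless_op_def)
  have sum: "(\<Sum>v\<in>verts G. f v) = f c + (\<Sum>l\<in>L. f l)" for f :: "'a \<Rightarrow> real"
    using assms(1,2) fin by simp
  {
    fix \<theta> assume "\<theta> \<in> main_spectrum G"
    then obtain f where f: "\<And>v. v \<in> verts G \<Longrightarrow> signless_op G f v = \<theta> * f v"
      and ne: "(\<Sum>v\<in>verts G. f v) \<noteq> 0"
      by (rule main_spectrumE) blast
    define S where "S = (\<Sum>l\<in>L. f l)"
    have c: "?p * f c + S = \<theta> * f c" using f[of c] assms(1) by (simp add: op S_def)
    have "(\<Sum>l\<in>L. f l + f c) = (\<Sum>l\<in>L. \<theta> * f l)"
      using f assms(1) by (intro sum.cong) (auto simp: op(2)[symmetric])
    then have l: "S + ?p * f c = \<theta> * S" by (simp add: sum.distrib S_def sum_distrib_left)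
    have "\<theta> * (f c - S) = 0" using c l by (simp add: algebra_simps)
    moreover have "\<theta> = ?p + 1" if "f c = S"
    proof -
      have "S \<noteq> 0" using ne that by (simp add: sum S_def[symmetric])
      moreover have "(?p + 1) * S = \<theta> * S" using l that by (simp add: algebra_simps)
      ultimately show ?thesis by simp
    qed
    ultimately show "\<theta> \<in> {0, ?p + 1}" by auto
  next
    fix \<theta> assume "\<theta> \<in> {0, ?p + 1}"
    then consider "\<theta> = 0" | "\<theta> = ?p + 1" by blast
    then show "\<theta> \<in> main_spectrum G"
    proof cases
      case 1
      \<comment> \<open>Alternating signs on the two sides of the bipartition; the sum
        \<open>1 - ?p\<close> is nonzero since there are at least two leaves.\<close>
      define f where "f v = (if v = c then 1 else - 1 :: real)" for v
      have L: "(\<Sum>l\<in>L. f l) = - ?p"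
        using assms(2) by (subst sum.cong[OF refl, of _ _ "\<lambda>_. - 1"]) (auto simp: f_def)
      show ?thesis
      proof (rule main_spectrumI[of _ f])
        fix v assume "v \<in> verts G"
        then consider "v = c" | "v \<in> L" using assms(1) by blast
        then show "signless_op G f v = \<theta> * f v"
          using assms(2) by cases (auto simp: op L 1, auto simp: f_def)
      qed (use assms(5) in \<open>simp add: sum L, simp add: f_def\<close>)
    next
      case 2
      define f where "f v = (if v = c then ?p else 1)" for v
      have L: "(\<Sum>l\<in>L. f l) = ?p"
        using assms(2) by (subst sum.cong[OF refl, of _ _ "\<lambda>_. 1"]) (auto simp: f_def)
      show ?thesis
      proof (rule main_spectrumI[of _ f])
        fix v assume "v \<in> verts G"
        then consider "v = c" | "v \<in> L" using assms(1) by blast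
        then show "signless_op G f v = \<theta> * f v"
          using assms(2) by cases (auto simp: op L 2, auto simp: f_def algebra_simps)
      qed (use assms(5) in \<open>simp add: sum L, simp add: f_def\<close>)
    qed
  }
qed

text \<open>Let \<open>C\<close> and \<open>S\<close> be the sums over centres and leaves. Adding
  the eigenvalue equations over each class gives a system of two equations in \<open>C\<close> and
  \<open>S\<close>; eliminating \<open>S\<close> leaves the quadratic times
  \<open>C\<close>.\<close>

lemma main_spectrum_double_star:
  assumes "verts G = {u, v} \<union> L \<union> M" "u \<noteq> v" "u \<notin> L \<union> M" "v \<notin> L \<union> M" "L \<inter> M = {}"
    and "neighbours G u = insert v L" "neighbours G v = insert u M"
    and "\<And>l. l \<in> L \<Longrightarrow> neighbours G l = {u}" "\<And>m. m \<in> M \<Longrightarrow> neighbours G m = {v}"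
    and "card L = p" "card M = p" "p \<ge> 1"
  shows "main_spectrum G = {\<theta>. \<theta>\<^sup>2 - (real p + 3) * \<theta> + 2 = 0}"
proof (intro Set.set_eqI iffI)
  have fin: "finite L" "finite M" using finite_verts assms(1) by auto
  have op: "signless_op G f u = (real p + 1) * f u + f v + (\<Sum>l\<in>L. f l)"
    "signless_op G f v = (real p + 1) * f v + f u + (\<Sum>m\<in>M. f m)"
    "\<And>l. l \<in> L \<Longrightarrow> signless_op G f l = f l + f u"
    "\<And>m. m \<in> M \<Longrightarrow> signless_op G f m = f m + f v" for f
    using assms fin by (simp_all add: signless_op_def)
  have sum: "(\<Sum>w\<in>verts G. f w) = f u + f v + (\<Sum>l\<in>L. f l) + (\<Sum>m\<in>M. f m)" for f :: "'a \<Rightarrow> real"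
    using assms(1-5) fin by (simp add: sum.union_disjoint Un_assoc)
  {
    fix \<theta> assume "\<theta> \<in> main_spectrum G"
    then obtain f where f: "\<And>v. v \<in> verts G \<Longrightarrow> signless_op G f v = \<theta> * f v"
      and ne: "(\<Sum>v\<in>verts G. f v) \<noteq> 0"
      by (rule main_spectrumE) blast
    define C S where "C = f u + f v" and "S = (\<Sum>l\<in>L. f l) + (\<Sum>m\<in>M. f m)"
    have c: "(real p + 2) * C + S = \<theta> * C"
      using f[of u] f[of v] assms(1) by (simp add: op C_def S_def algebra_simps)
    have "(\<Sum>l\<in>L. f l + f u) = (\<Sum>l\<in>L. \<theta> * f l)" "(\<Sum>m\<in>M. f m + f v) = (\<Sum>m\<in>M. \<theta> * f m)"
      using f assms(1) by (auto simp: op(3,4)[symmetric] intro!: sum.cong)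
    then have l: "S + p * C = \<theta> * S"
      using assms(10,11) by (simp add: sum.distrib S_def C_def sum_distrib_left[symmetric] algebra_simps)
    have S: "S = (\<theta> - (real p + 2)) * C" using c by (simp add: algebra_simps)
    \<comment> \<open>With \<open>C = 0\<close> also \<open>S = 0\<close>, and the total would
      vanish.\<close>
    have "C \<noteq> 0" using ne S by (auto simp: sum C_def[symmetric] S_def[symmetric] add.assoc)
    moreover have "(\<theta>\<^sup>2 - (real p + 3) * \<theta> + 2) * C = 0"
      using l unfolding S by (simp add: algebra_simps power2_eq_square)
    ultimately show "\<theta> \<in> {\<theta>. \<theta>\<^sup>2 - (real p + 3) * \<theta> + 2 = 0}" by simp
  next
    fix \<theta> assume "\<theta> \<in> {\<theta>. \<theta>\<^sup>2 - (real p + 3) * \<theta> + 2 = 0}"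
    then have \<theta>: "\<theta>\<^sup>2 - (real p + 3) * \<theta> + 2 = 0" by simp
    \<comment> \<open>This product equals \<open>\<theta>^2 + 2\<close>. Positivity of
      \<open>\<theta>\<close> later makes the sum of the eigenfunction nonzero.\<close>
    then have "(real p + 3) * \<theta> > 0" by (smt (verit) zero_le_power2)
    then have pos: "\<theta> > 0" by (simp add: zero_less_mult_iff)
    \<comment> \<open>With value one at the leaves, the leaf equations force
      \<open>\<theta> - 1\<close> at the centres; the equations at the centres are then the
      quadratic.\<close>
    define f where "f w = (if w \<in> {u, v} then \<theta> - 1 else 1)" for w
    have c: "f u = \<theta> - 1" "f v = \<theta> - 1" and leaf: "\<And>w. w \<in> L \<union> M \<Longrightarrow> f w = 1"
      using assms(3,4) by (auto simp: f_def)
    have LM: "(\<Sum>l\<in>L. f l) = real p" "(\<Sum>m\<in>M. f m) = real p"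
      using leaf assms(10,11) by simp_all
    show "\<theta> \<in> main_spectrum G"
    proof (rule main_spectrumI[of _ f])
      fix w assume "w \<in> verts G"
      then consider "w = u" | "w = v" | "w \<in> L" | "w \<in> M" using assms(1) by blast
      then show "signless_op G f w = \<theta> * f w"
        using \<theta> assms(10,11) by cases (simp_all add: op c leaf LM algebra_simps power2_eq_square)
    next
      have "f u + f v + (\<Sum>l\<in>L. f l) + (\<Sum>m\<in>M. f m) = 2 * (\<theta> + (real p - 1))"
        by (simp add: c LM)
      moreover have "\<theta> + (real p - 1) > 0" using pos assms(12) by simp
      ultimately show "(\<Sum>w\<in>verts G. f w) \<noteq> 0" by (simp add: sum)
    qed
  }
qed

end

section \<open>Counting the main eigenvalues, and the equivalence\<close>

lemma card_quadratic_roots: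
  fixes b c :: real
  assumes "b\<^sup>2 - 4 * c > 0"
  shows "card {x. x\<^sup>2 - b * x + c = 0} = 2"
proof -
  define s where "s = sqrt (b\<^sup>2 - 4 * c)"
  have s: "s > 0" "s * s = b * b - 4 * c" using assms by (simp_all add: s_def power2_eq_square)
  have "x\<^sup>2 - b * x + c = (x - (b + s) / 2) * (x - (b - s) / 2)" for x
    using s(2) by (simp add: field_simps power2_eq_square)
  then have "{x. x\<^sup>2 - b * x + c = 0} = {(b + s) / 2, (b - s) / 2}" by auto
  then show ?thesis using s(1) by simp
qed

lemma card_main_spectrum_star:
  assumes "K\<^bsub>1, n - 1\<^esub> G" "n \<ge> 3"
  shows "card (main_spectrum G) = 2"
proof -
  interpret graph G using assms(1) by (simp add: complete_bipartite_digraph_def)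
  obtain c L where "verts G = {c} \<union> L" "{c} \<inter> L = {}" "card L = n - 1"
    "arcs_ends G = {c} \<times> L \<union> L \<times> {c}"
    using assms(1) unfolding complete_bipartite_digraph_def by (metis card_1_singletonE)
  then have "main_spectrum G = {0, real (card L) + 1}"
    using assms(2) by (intro main_spectrum_star[of c]) (auto simp: neighbours_def)
  then show ?thesis by simp
qed

lemma card_main_spectrum_double_star:
  assumes "double_star m m G" "m \<ge> 2"
  shows "card (main_spectrum G) = 2"
proof -
  interpret graph G using assms(1) by (simp add: double_star_def)
  obtain u v L M where uv: "verts G = {u, v} \<union> L \<union> M" "u \<noteq> v" "u \<notin> L \<union> M" "v \<notin> L \<union> M"
    "L \<inter> M = {}" and card: "card L + 1 = m" "card M + 1 = m"
    and arcs: "arcs_ends G = ({(u, v)} \<union> {u} \<times> L \<union> {v} \<times> M)\<^sup>s"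
    using assms(1) unfolding double_star_def by blast
  have "main_spectrum G = {\<theta>. \<theta>\<^sup>2 - (real (m - 1) + 3) * \<theta> + 2 = 0}"
    by (rule main_spectrum_double_star[OF uv])
      (use uv card assms(2) in \<open>auto simp: neighbours_def arcs symcl_def\<close>)
  \<comment> \<open>Bounds the discriminant from below by \<open>9 - 8\<close>, so there are two
    distinct roots.\<close>
  moreover have "(real (m - 1) + 3)\<^sup>2 \<ge> 3\<^sup>2" by (rule power_mono) auto
  ultimately show ?thesis using card_quadratic_roots[of "real (m - 1) + 3" 2] by simp
qed

theorem theorem7:
  fixes G :: "('a, 'b) pre_digraph" and vs :: "'a list" and n :: nat
  assumes "undirected_tree G"
    and "card (verts G) = n" and "n \<ge> 3"
    and "distinct vs" and "set vs = verts G"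
  shows "card {\<mu>. main_signless_laplacian_eigenvalue G vs \<mu>} = 2 \<longleftrightarrow>
    K\<^bsub>1, n - 1\<^esub> G \<or> (even n \<and> double_star (n div 2) (n div 2) G)"
proof -
  have "graph G" and tree: "connected G" "\<And>p. \<lbrakk>pre_digraph.cycle G p; 3 \<le> length p\<rbrakk> \<Longrightarrow> False"
    using assms(1) unfolding undirected_tree_def by auto
  interpret graph G by fact
  interpret tree_graph G using tree by unfold_locales
  have "{\<mu>. main_signless_laplacian_eigenvalue G vs \<mu>} = main_spectrum G"
    using main_signless_laplacian_eigenvalue_iff[OF assms(4,5)] by simp
  moreover have "card (main_spectrum G) = 2 \<longleftrightarrow>
    K\<^bsub>1, n - 1\<^esub> G \<or> (even n \<and> double_star (n div 2) (n div 2) G)"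
  proof
    assume "card (main_spectrum G) = 2"
    then obtain \<mu>\<^sub>1 \<mu>\<^sub>2 where "main_spectrum G \<subseteq> {\<mu>\<^sub>1, \<mu>\<^sub>2}" by (auto simp: card_2_iff)
    then obtain a b where "\<And>v. v \<in> verts G \<Longrightarrow>
      (\<Sum>w\<in>neighbours G v. real (card (neighbours G w)))
        = a * real (card (neighbours G v)) - (real (card (neighbours G v)))\<^sup>2 + b"
      using degree_equation by blast
    then show "K\<^bsub>1, n - 1\<^esub> G \<or> (even n \<and> double_star (n div 2) (n div 2) G)"
      using star_or_double_star assms(2,3) by blast
  next
    assume "K\<^bsub>1, n - 1\<^esub> G \<or> (even n \<and> double_star (n div 2) (n div 2) G)"
    then show "card (main_spectrum G) = 2"
    proof
      assume "even n \<and> double_star (n div 2) (n div 2) G"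
      moreover from this have "even n" by blast
      \<comment> \<open>An even \<open>n \<ge> 3\<close> is at least four, so each centre has a
        pendant vertex.\<close>
      then have "n div 2 \<ge> 2" using assms(3) by presburger
      ultimately show ?thesis using card_main_spectrum_double_star by blast
    qed (rule card_main_spectrum_star[OF _ assms(3)])
  qed
  ultimately show ?thesis by simp
qed

end
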